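(* Let $k\in\mathcal{C}=\{1,\dots,m\}$. For every $\mathcal{X}\subseteq\mathcal{C}\setminus\{k\}$, $$v(\mathcal{X}\cup\{k\};t)=v(\mathcal{X};\bar t)+f_kt_k,$$ where, for $j\in\{0,1,\dots,m\}\setminus\{k\}$, $$\bar t_j=\begin{cases}(1-f_k)t_j,&t_j\le t_k,\\ t_j-f_kt_k,&t_j>t_k.\end{cases}$$
   Context: Here $0\le t_0<t_1\le\cdots\le t_m$ are real numbers, $f_1,\dots,f_m\in(0,1]$, and $Z_1,\dots,Z_m$ are independent Bernoulli random variables with $\Pr(Z_j=1)=f_j$. For nonnegative utilities $s=(s_j)$ (including an outside utility $s_0$), $v(\mathcal{X};s)=\operatorname{E}\bigl[\max\{s_0,\max\{s_jZ_j: j\in\mathcal{X}\}\}\bigr]$ denotes the portfolio valuation function with utility parameters $s$ (and the same $f_j$), with $v(\varnothing;s)=s_0$. The function $v(\cdot;\bar t)$ is considered on subsets of $\mathcal{C}\setminus\{k\}$. *)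

theory Defs
  imports "HOL-Probability.Probability"
begin

(* of_bool transports the library's boolean-valued Bernoulli distribution to the reals. *)
definition bernoulli_rv :: "'a measure \<Rightarrow> real \<Rightarrow> ('a \<Rightarrow> real) \<Rightarrow> bool" where
  "bernoulli_rv M p Y \<longleftrightarrow>
     Y \<in> borel_measurable M \<and>
     distr M borel Y = distr (measure_pmf (bernoulli_pmf p)) borel of_bool"

(* Index 0 is the outside option. Inserting its utility into the set of realized
   utilities keeps the maximum meaningful for X = {}, where the value is s 0. *)
definition portfolio_value ::
  "'a measure \<Rightarrow> (nat \<Rightarrow> 'a \<Rightarrow> real) \<Rightarrow> nat set \<Rightarrow> (nat \<Rightarrow> real) \<Rightarrow> real" where
  "portfolio_value M Z X s =
     prob_space.expectation M (\<lambda>\<omega>. Max (insert (s 0) ((\<lambda>j. s j * Z j \<omega>) ` X)))"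

(* Meant for j \<noteq> k only; the value at j = k is an artefact of totality. *)
definition transformed_utility ::
  "(nat \<Rightarrow> real) \<Rightarrow> (nat \<Rightarrow> real) \<Rightarrow> nat \<Rightarrow> nat \<Rightarrow> real" where
  "transformed_utility f t k j =
     (if t j \<le> t k then (1 - f k) * t j else t j - f k * t k)"

end

theory Submission
  imports Defs
begin

text \<open>
  Let \<open>W\<close> be the value realized by \<open>X\<close> and write \<open>\<phi> w = (1 - f k) * w + f k * max w (t k) - f k * t k\<close>.
  Conditioning on the independent \<open>Z k\<close> shows that the value of \<open>X \<union> {k}\<close> is
  \<open>E (\<phi> W) + f k * t k\<close>. Since \<open>\<phi>\<close> is nondecreasing with \<open>\<phi> 0 = 0\<close>, it commutes with the maximum
  and with multiplication by \<open>Z j \<in> {0, 1}\<close>; the transformed utilities are \<open>\<phi> (t j)\<close>.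
\<close>

text \<open>Only the law of \<open>Y\<close> is prescribed, so other values can occur on a null set.
  This is why the identities between realized values below are proved almost everywhere.\<close>

lemma bernoulli_rv_AE_01:
  assumes "bernoulli_rv M p Y"
  shows "AE \<omega> in M. Y \<omega> \<in> {0, 1}"
proof -
  have m: "Y \<in> borel_measurable M"
    and d: "distr M borel Y = distr (measure_pmf (bernoulli_pmf p)) borel of_bool"
    using assms by (auto simp: bernoulli_rv_def)
  have "AE x in distr (measure_pmf (bernoulli_pmf p)) borel of_bool. x \<in> {0, 1::real}"
    by (subst AE_distr_iff) auto
  then have "AE x in distr M borel Y. x \<in> {0, 1}"
    by (simp only: d)
  then show ?thesis
    by (subst (asm) AE_distr_iff) (use m in auto)
qed

lemma bernoulli_rv_expectation:
  assumes "bernoulli_rv M p Y" "0 \<le> p" "p \<le> 1"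
  shows "(\<integral>\<omega>. Y \<omega> \<partial>M) = p"
proof -
  have m: "Y \<in> borel_measurable M"
    and d: "distr M borel Y = distr (measure_pmf (bernoulli_pmf p)) borel of_bool"
    using assms by (auto simp: bernoulli_rv_def)
  have "(\<integral>\<omega>. Y \<omega> \<partial>M) = (\<integral>x. x \<partial>distr M borel Y)"
    using m by (simp add: integral_distr)
  also have "\<dots> = (\<integral>b. of_bool b \<partial>measure_pmf (bernoulli_pmf p))"
    by (simp add: d integral_distr)
  also have "\<dots> = p"
    using assms(2,3) by simp
  finally show ?thesis .
qed

text \<open>The inserted constant can be split off as a binary \<open>max\<close> only for nonempty
  \<open>X\<close>, since \<open>Max {}\<close> is unspecified. The measure \<open>N\<close> is
  arbitrary because the lemma serves both \<open>M\<close> and a product space of outcome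
  vectors.\<close>

lemma borel_measurable_Max_insert:
  fixes g :: "'i \<Rightarrow> 'a \<Rightarrow> real"
  assumes "finite X" and g: "\<And>j. j \<in> X \<Longrightarrow> g j \<in> borel_measurable N"
  shows "(\<lambda>x. Max (insert c ((\<lambda>j. g j x) ` X))) \<in> borel_measurable N"
proof (cases "X = {}")
  case False
  then have "(\<lambda>x. Max (insert c ((\<lambda>j. g j x) ` X))) = (\<lambda>x. max c (Max ((\<lambda>j. g j x) ` X)))"
    using assms(1) by simp
  moreover have "(\<lambda>x. Max ((\<lambda>j. g j x) ` X)) \<in> borel_measurable N"
    using assms by (intro borel_measurable_Max) auto
  ultimately show ?thesis
    by simp
qed simp

text \<open>The \<open>max\<close> absorbs the case distinction, so both branches become values of
  one and the same function at \<open>t j\<close>.\<close>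

lemma transformed_utility_eq:
  "transformed_utility f t k j = (1 - f k) * t j + f k * max (t j) (t k) - f k * t k"
  by (auto simp: transformed_utility_def algebra_simps max_def)

theorem lemma2:
  fixes M :: "'a measure" and Z :: "nat \<Rightarrow> 'a \<Rightarrow> real"
    and f t :: "nat \<Rightarrow> real" and m k :: nat and X :: "nat set"
  assumes "prob_space M"
    and "0 \<le> t 0" and "t 0 < t 1" and "\<And>j. j \<in> {1..<m} \<Longrightarrow> t j \<le> t (Suc j)"
    and "\<And>j. j \<in> {1..m} \<Longrightarrow> 0 < f j \<and> f j \<le> 1"
    and "\<And>j. j \<in> {1..m} \<Longrightarrow> bernoulli_rv M (f j) (Z j)"
    and "prob_space.indep_vars M (\<lambda>_. borel) Z {1..m}"
    and "k \<in> {1..m}"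
    and "X \<subseteq> {1..m} - {k}"
  shows "portfolio_value M Z (X \<union> {k}) t =
         portfolio_value M Z X (transformed_utility f t k) + f k * t k"
proof -
  interpret prob_space M by fact
  define \<phi> where "\<phi> x = (1 - f k) * x + f k * max x (t k) - f k * t k" for x
  define W where "W = (\<lambda>\<omega>. Max (insert (t 0) ((\<lambda>j. t j * Z j \<omega>) ` X)))"
  \<comment> \<open>The gain over \<open>W\<close> when option \<open>k\<close> succeeds. The
    portfolio with \<open>k\<close> then realizes \<open>W + Z k * D\<close>, where the two factors
    of the product are independent.\<close>
  define D where "D = (\<lambda>\<omega>. max (W \<omega>) (t k) - W \<omega>)"
  have fk: "0 < f k" "f k \<le> 1"
    using assms(5,8) by auto
  have X: "X \<subseteq> {1..m}" "k \<notin> X" and fin: "finite X"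
    using assms(9) finite_subset[OF assms(9)] by auto
  have t_nonneg: "0 \<le> t j" if "j \<in> {1..m}" for j
  proof -
    from that have "1 \<le> j" "j \<le> m" by auto
    then show ?thesis
    \<comment> \<open>The ordering within the options starts at index 1, so the induction does too;
      its base case comes from the outside utility.\<close>
    proof (induction j rule: dec_induct)
      case base
      show ?case using assms(2,3) by simp
    next
      case (step n)
      then show ?case using assms(4)[of n] by simp
    qed
  qed
  have Z_meas [measurable]: "Z j \<in> borel_measurable M" if "j \<in> {1..m}" for j
    using assms(6)[OF that] by (simp add: bernoulli_rv_def)
  have W_meas [measurable]: "W \<in> borel_measurable M"
    unfolding W_def by (rule borel_measurable_Max_insert) (use fin X in auto)
  have Z01: "AE \<omega> in M. \<forall>j\<in>{1..m}. Z j \<omega> \<in> {0, 1}"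
    using assms(6) by (intro AE_finite_allI bernoulli_rv_AE_01) auto
  have tk: "0 \<le> t k"
    using t_nonneg assms(8) by simp

  have W_nonneg: "0 \<le> W \<omega>" for \<omega>
  proof -
    have "t 0 \<le> W \<omega>"
      unfolding W_def using fin by simp
    with assms(2) show ?thesis by linarith
  qed
  \<comment> \<open>A crude constant bound suffices for integrability: a sum of nonnegative
    utilities dominates each of them.\<close>
  have W_le: "AE \<omega> in M. W \<omega> \<le> (\<Sum>j\<in>insert 0 X. t j)"
    using Z01
  proof eventually_elim
    case (elim \<omega>)
    have tX: "0 \<le> t i" if "i \<in> insert 0 X" for i
      using that t_nonneg assms(2) X by auto
    have le: "t i \<le> (\<Sum>j\<in>insert 0 X. t j)" if "i \<in> insert 0 X" for i
      using that tX fin by (intro member_le_sum) auto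
    have "t i * Z i \<omega> \<le> t i" if "i \<in> X" for i
    proof -
      have "Z i \<omega> \<in> {0, 1}" using elim that X by blast
      then show ?thesis using tX[of i] that by auto
    qed
    then show ?case
      unfolding W_def using fin le by (auto intro: order_trans)
  qed
  have W_int: "integrable M W"
    by (rule integrable_const_bound[where B = "\<Sum>j\<in>insert 0 X. t j"])
       (use W_le in eventually_elim, use W_nonneg in \<open>simp_all del: sum.insert\<close>)
  have D_int: "integrable M D"
    unfolding D_def using W_int by (intro Bochner_Integration.integrable_diff integrable_max) auto
  have Zk_int: "integrable M (Z k)"
    by (rule integrable_const_bound[where B = 1])
       (use bernoulli_rv_AE_01[OF assms(6)[OF assms(8)]] in eventually_elim, use assms(8) in auto)

  have indep: "indep_var borel (Z k) borel D"
  proof -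
    \<comment> \<open>\<open>h\<close> is \<open>W\<close> as a function of the outcome vector.
      Hence \<open>D\<close> depends only on the coordinates in \<open>X\<close>, which is disjoint
      from \<open>{k}\<close>.\<close>
    define h where "h = (\<lambda>z. Max (insert (t 0) ((\<lambda>j. t j * z j) ` X)))"
    have h [measurable]: "h \<in> borel_measurable (PiM X (\<lambda>_. borel))"
      unfolding h_def by (rule borel_measurable_Max_insert) (use fin in measurable)
    have "indep_var (PiM {k} (\<lambda>_. borel)) (\<lambda>\<omega>. restrict (\<lambda>i. Z i \<omega>) {k})
                    (PiM X (\<lambda>_. borel)) (\<lambda>\<omega>. restrict (\<lambda>i. Z i \<omega>) X)"
      using assms(8) X by (intro indep_var_restrict[OF assms(7)]) auto
    then have "indep_var borel ((\<lambda>z. z k) \<circ> (\<lambda>\<omega>. restrict (\<lambda>i. Z i \<omega>) {k}))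
                  borel ((\<lambda>z. max (h z) (t k) - h z) \<circ> (\<lambda>\<omega>. restrict (\<lambda>i. Z i \<omega>) X))"
      by (rule indep_var_compose) measurable
    moreover have "h (restrict (\<lambda>i. Z i \<omega>) X) = W \<omega>" for \<omega>
      by (simp add: h_def W_def)
    ultimately show ?thesis
      by (simp add: comp_def D_def)
  qed

  have \<phi>_mono: "mono \<phi>"
  proof (rule monoI)
    fix x y :: real
    assume "x \<le> y"
    then have "(1 - f k) * x \<le> (1 - f k) * y" "f k * max x (t k) \<le> f k * max y (t k)"
      using fk by (auto intro!: mult_left_mono)
    then show "\<phi> x \<le> \<phi> y"
      by (simp add: \<phi>_def)
  qed
  \<comment> \<open>The shift by \<open>f k * t k\<close> in \<open>\<phi>\<close> is chosen for
    this: a failed option must contribute 0 after the transformation as well.\<close>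
  have \<phi>_0: "\<phi> 0 = 0"
    using tk by (simp add: \<phi>_def)
  have bar: "transformed_utility f t k j = \<phi> (t j)" for j
    by (simp add: transformed_utility_eq \<phi>_def)

  have "portfolio_value M Z (X \<union> {k}) t = expectation (\<lambda>\<omega>. W \<omega> + Z k \<omega> * D \<omega>)"
    unfolding portfolio_value_def
  proof (rule integral_cong_AE)
    show "(\<lambda>\<omega>. Max (insert (t 0) ((\<lambda>j. t j * Z j \<omega>) ` (X \<union> {k})))) \<in> borel_measurable M"
      by (rule borel_measurable_Max_insert) (use fin X assms(8) in auto)
    show "(\<lambda>\<omega>. W \<omega> + Z k \<omega> * D \<omega>) \<in> borel_measurable M"
      using assms(8) unfolding D_def by measurable
    show "AE \<omega> in M. Max (insert (t 0) ((\<lambda>j. t j * Z j \<omega>) ` (X \<union> {k}))) = W \<omega> + Z k \<omega> * D \<omega>"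
      using Z01
    proof eventually_elim
      case (elim \<omega>)
      have "insert (t 0) ((\<lambda>j. t j * Z j \<omega>) ` (X \<union> {k})) =
          insert (t k * Z k \<omega>) (insert (t 0) ((\<lambda>j. t j * Z j \<omega>) ` X))"
        by auto
      then have "Max (insert (t 0) ((\<lambda>j. t j * Z j \<omega>) ` (X \<union> {k}))) = max (t k * Z k \<omega>) (W \<omega>)"
        unfolding W_def using fin by (simp del: insert_iff add: Max_insert)
      moreover have "Z k \<omega> \<in> {0, 1}"
        using elim assms(8) by blast
      \<comment> \<open>If \<open>Z k\<close> is 0, nonnegativity of \<open>W\<close> makes the term
        for \<open>k\<close> irrelevant; if it is 1, the maximum is \<open>W + D\<close>.\<close>
      ultimately show ?case
        using W_nonneg[of \<omega>] by (auto simp: D_def max_def)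
    qed
  qed
  also have "\<dots> = expectation W + f k * expectation D"
  proof -
    have "expectation (\<lambda>\<omega>. Z k \<omega> * D \<omega>) = f k * expectation D"
      using indep_var_lebesgue_integral[OF indep Zk_int D_int]
        bernoulli_rv_expectation[OF assms(6)[OF assms(8)]] fk by simp
    then show ?thesis
      using W_int indep_var_integrable[OF indep Zk_int D_int] by simp
  qed
  \<comment> \<open>Moving the constant inside completes the integrand to
    \<open>\<phi> (W \<omega>)\<close>; it equals its own expectation because \<open>M\<close> has
    total mass 1.\<close>
  also have "\<dots> = expectation (\<lambda>\<omega>. W \<omega> + f k * D \<omega> - f k * t k) + f k * t k"
    using W_int D_int by (simp add: prob_space)
  also have "(\<lambda>\<omega>. W \<omega> + f k * D \<omega> - f k * t k) = (\<lambda>\<omega>. \<phi> (W \<omega>))"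
    by (simp add: \<phi>_def D_def algebra_simps)
  also have "expectation (\<lambda>\<omega>. \<phi> (W \<omega>)) = portfolio_value M Z X (transformed_utility f t k)"
    unfolding portfolio_value_def
  proof (rule integral_cong_AE)
    show "(\<lambda>\<omega>. \<phi> (W \<omega>)) \<in> borel_measurable M"
      unfolding \<phi>_def by measurable
    show "(\<lambda>\<omega>. Max (insert (transformed_utility f t k 0)
        ((\<lambda>j. transformed_utility f t k j * Z j \<omega>) ` X))) \<in> borel_measurable M"
      by (rule borel_measurable_Max_insert) (use fin X in auto)
    show "AE \<omega> in M. \<phi> (W \<omega>) = Max (insert (transformed_utility f t k 0)
        ((\<lambda>j. transformed_utility f t k j * Z j \<omega>) ` X))"
      using Z01
    proof eventually_elim
      case (elim \<omega>)
      have "\<phi> (t j * Z j \<omega>) = transformed_utility f t k j * Z j \<omega>" if "j \<in> X" for j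
      proof -
        have "Z j \<omega> \<in> {0, 1}" using elim that X by blast
        then show ?thesis by (auto simp: bar \<phi>_0)
      qed
      then have "\<phi> ` insert (t 0) ((\<lambda>j. t j * Z j \<omega>) ` X) =
          insert (transformed_utility f t k 0) ((\<lambda>j. transformed_utility f t k j * Z j \<omega>) ` X)"
        by (simp add: bar image_image)
      \<comment> \<open>The element \<open>t 0\<close> keeps the set nonempty, so
        \<open>\<phi>\<close> can be moved through \<open>Max\<close> even for
        \<open>X = {}\<close>.\<close>
      then show ?case
        unfolding W_def using mono_Max_commute[OF \<phi>_mono] fin by simp
    qed
  qed
  finally show ?thesis .
qed

end
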